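(* Let $(A,\cdot,\circ)$ be a nonzero $2$-dimensional anti-pre-Lie Poisson algebra over $\mathbb C$. Then $A$ is isomorphic to one of the following algebras with basis $e_1,e_2$ (where $\alpha,\beta,\lambda\in\mathbb C$). (a) Algebras with zero product $\cdot$: $A_{01}: e_1\circ e_1=e_1,\ e_2\circ e_2=e_2$; $A_{02}: e_1\circ e_1=e_1,\ e_1\circ e_2=e_2,\ e_2\circ e_1=e_2$; $A_{03}: e_1\circ e_1=e_1$; $A_{04}: e_1\circ e_1=e_2$; $A_{05}: e_1\circ e_1=-e_2,\ e_2\circ e_1=-e_1$; $A_{06}^{\lambda}: e_2\circ e_1=-e_1,\ e_2\circ e_2=\lambda e_2$; $A_{07}: e_2\circ e_1=-e_1,\ e_2\circ e_2=e_1-e_2$; $A_{08}^{\lambda}$ with $\lambda\neq-1$: $e_1\circ e_2=(\lambda+1)e_1,\ e_2\circ e_1=\lambda e_1,\ e_2\circ e_2=(\lambda-1)e_2$; $A_{09}: e_1\circ e_2=-e_1,\ e_2\circ e_1=-2e_1,\ e_2\circ e_2=e_1-3e_2$. (b) Algebras with nonzero product $\cdot$: $A_{10}^{\alpha,\beta}: e_1\cdot e_1=e_1,\ e_2\cdot e_2=e_2,\ e_1\circ e_1=\alpha e_1,\ e_2\circ e_2=\beta e_2$; $A_{11}^{\alpha,\beta}: e_1\cdot e_1=e_1,\ e_1\cdot e_2=e_2,\ e_1\circ e_1=(2\alpha-\beta)e_1+e_2,\ e_1\circ e_2=\alpha e_2,\ e_2\circ e_1=\beta e_2$; $A_{12}^{\alpha,\beta}: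 e_1\cdot e_1=e_1,\ e_1\cdot e_2=e_2,\ e_1\circ e_1=(2\alpha-\beta)e_1,\ e_1\circ e_2=\alpha e_2,\ e_2\circ e_1=\beta e_2$; $A_{13}^{\alpha}: e_1\cdot e_1=e_1,\ e_1\circ e_1=\alpha e_1,\ e_2\circ e_2=e_2$; $A_{14}^{\alpha}: e_1\cdot e_1=e_1,\ e_1\circ e_1=\alpha e_1$; $A_{15}^{\alpha}$ with $\alpha\neq\frac12$: $e_1\cdot e_1=e_2,\ e_1\circ e_1=(2-\alpha)e_1,\ e_1\circ e_2=e_2,\ e_2\circ e_1=\alpha e_2$; $A_{16}^{\alpha}: e_1\cdot e_1=e_2,\ e_1\circ e_1=\frac32e_1+\alpha e_2,\ e_1\circ e_2=e_2,\ e_2\circ e_1=\frac12e_2$; $A_{17}: e_1\cdot e_1=e_2,\ e_1\circ e_1=-e_1,\ e_2\circ e_1=e_2$; $A_{18}^{\alpha}: e_1\cdot e_1=e_2,\ e_1\circ e_1=\alpha e_2$. Between the algebras in (b), the only non-trivial isomorphisms are $A_{10}^{\alpha,\beta}\cong A_{10}^{\beta,\alpha}$.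
   Context: An anti-pre-Lie algebra is a complex vector space with a bilinear product $\circ$ such that, writing $[x,y]=x\circ y-y\circ x$, one has $x\circ(y\circ z)-y\circ(x\circ z)=[y,x]\circ z$ and $[x,y]\circ z+[y,z]\circ x+[z,x]\circ y=0$. An anti-pre-Lie Poisson algebra is a complex vector space with a commutative associative product $\cdot$ and an anti-pre-Lie product $\circ$ such that $2(x\circ y)\cdot z-2(y\circ x)\cdot z=y\cdot(x\circ z)-x\cdot(y\circ z)$ and $2\,x\circ(y\cdot z)=(z\cdot x)\circ y+z\cdot(x\circ y)$. It is nonzero if the two products are not both zero. Isomorphisms are linear bijections preserving both products. In multiplication tables, products of basis elements not listed are zero, except that $e_2\cdot e_1=e_1\cdot e_2$ by commutativity of $\cdot$. *)

theory Defs
  imports "HOL-Analysis.Analysis"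
begin

section \<open>Anti-pre-Lie Poisson algebras\<close>

locale anti_pre_lie_algebra = vector_space scale
  for scale :: "complex \<Rightarrow> 'a::ab_group_add \<Rightarrow> 'a" +
  fixes circ :: "'a \<Rightarrow> 'a \<Rightarrow> 'a"  (infixl "\<circ>\<circ>" 70)
  assumes circ_linear_left: "Vector_Spaces.linear scale scale (\<lambda>x. x \<circ>\<circ> y)"
    and circ_linear_right: "Vector_Spaces.linear scale scale (\<lambda>y. x \<circ>\<circ> y)"
    and circ_representation:
      "x \<circ>\<circ> (y \<circ>\<circ> z) - y \<circ>\<circ> (x \<circ>\<circ> z) = (y \<circ>\<circ> x - x \<circ>\<circ> y) \<circ>\<circ> z"
    and circ_cyclic:
      "(x \<circ>\<circ> y - y \<circ>\<circ> x) \<circ>\<circ> z + (y \<circ>\<circ> z - z \<circ>\<circ> y) \<circ>\<circ> x + (z \<circ>\<circ> x - x \<circ>\<circ> z) \<circ>\<circ> y = 0"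

locale anti_pre_lie_poisson_algebra = anti_pre_lie_algebra scale circ
  for scale :: "complex \<Rightarrow> 'a::ab_group_add \<Rightarrow> 'a"
    and dot :: "'a \<Rightarrow> 'a \<Rightarrow> 'a"  (infixl "\<bullet>\<bullet>" 70)
    and circ :: "'a \<Rightarrow> 'a \<Rightarrow> 'a"  (infixl "\<circ>\<circ>" 70) +
  assumes dot_linear_left: "Vector_Spaces.linear scale scale (\<lambda>x. x \<bullet>\<bullet> y)"
    and dot_linear_right: "Vector_Spaces.linear scale scale (\<lambda>y. x \<bullet>\<bullet> y)"
    and dot_commute: "x \<bullet>\<bullet> y = y \<bullet>\<bullet> x"
    and dot_assoc: "(x \<bullet>\<bullet> y) \<bullet>\<bullet> z = x \<bullet>\<bullet> (y \<bullet>\<bullet> z)"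
    and commutator_dot:
      "scale 2 ((x \<circ>\<circ> y) \<bullet>\<bullet> z) - scale 2 ((y \<circ>\<circ> x) \<bullet>\<bullet> z) = y \<bullet>\<bullet> (x \<circ>\<circ> z) - x \<bullet>\<bullet> (y \<circ>\<circ> z)"
    and circ_dot:
      "scale 2 (x \<circ>\<circ> (y \<bullet>\<bullet> z)) = (z \<bullet>\<bullet> x) \<circ>\<circ> y + z \<bullet>\<bullet> (x \<circ>\<circ> y)"

definition isomorphic_algebras ::
  "(complex \<Rightarrow> 'a::ab_group_add \<Rightarrow> 'a) \<Rightarrow> ('a \<Rightarrow> 'a \<Rightarrow> 'a) \<Rightarrow> ('a \<Rightarrow> 'a \<Rightarrow> 'a) \<Rightarrow>
   (complex \<Rightarrow> 'b::ab_group_add \<Rightarrow> 'b) \<Rightarrow> ('b \<Rightarrow> 'b \<Rightarrow> 'b) \<Rightarrow> ('b \<Rightarrow> 'b \<Rightarrow> 'b) \<Rightarrow> bool"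
  where "isomorphic_algebras smul dot circ smul' dot' circ' \<longleftrightarrow>
    (\<exists>f. Vector_Spaces.linear smul smul' f \<and> bij f \<and>
         (\<forall>x y. f (dot x y) = dot' (f x) (f y)) \<and>
         (\<forall>x y. f (circ x y) = circ' (f x) (f y)))"

section \<open>The algebras of the classification\<close>

abbreviation e1 :: "complex ^ 2" where "e1 \<equiv> axis 1 1"
abbreviation e2 :: "complex ^ 2" where "e2 \<equiv> axis 2 1"

text \<open>An entry \<open>(i, j, v)\<close> of a multiplication table says that the product of the \<open>i\<close>-th and
  the \<open>j\<close>-th basis vector is \<open>v\<close>. Each pair \<open>(i, j)\<close> may occur at most once, since repeated
  entries would add up; pairs that do not occur have product zero.\<close>

definition table_product ::
  "(2 \<times> 2 \<times> (complex ^ 2)) list \<Rightarrow> complex ^ 2 \<Rightarrow> complex ^ 2 \<Rightarrow> complex ^ 2"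
  where "table_product T x y = (\<Sum>(i, j, v) \<leftarrow> T. (x $ i * y $ j) *s v)"

text \<open>Names, rather than the algebras themselves, are used so that algebras listed under different
  names or parameters count as different entries of the list.\<close>

datatype algebra_name =
    A01 | A02 | A03 | A04 | A05 | A06 complex | A07 | A08 complex | A09
  | A10 complex complex | A11 complex complex | A12 complex complex
  | A13 complex | A14 complex | A15 complex | A16 complex | A17 | A18 complex

definition list_a :: "algebra_name set"
  where "list_a = {A01, A02, A03, A04, A05, A07, A09} \<union> range A06 \<union> {A08 l | l. l \<noteq> -1}"

definition list_b :: "algebra_name set"
  where "list_b = {A10 a b | a b. True} \<union> {A11 a b | a b. True} \<union> {A12 a b | a b. True} \<union>
    range A13 \<union> range A14 \<union> {A15 a | a. a \<noteq> 1/2} \<union> range A16 \<union> {A17} \<union> range A18"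

fun dot_table :: "algebra_name \<Rightarrow> (2 \<times> 2 \<times> (complex ^ 2)) list" where
  "dot_table (A10 a b) = [(1, 1, e1), (2, 2, e2)]"
| "dot_table (A11 a b) = [(1, 1, e1), (1, 2, e2), (2, 1, e2)]"
| "dot_table (A12 a b) = [(1, 1, e1), (1, 2, e2), (2, 1, e2)]"
| "dot_table (A13 a) = [(1, 1, e1)]"
| "dot_table (A14 a) = [(1, 1, e1)]"
| "dot_table (A15 a) = [(1, 1, e2)]"
| "dot_table (A16 a) = [(1, 1, e2)]"
| "dot_table A17 = [(1, 1, e2)]"
| "dot_table (A18 a) = [(1, 1, e2)]"
| "dot_table _ = []"

fun circ_table :: "algebra_name \<Rightarrow> (2 \<times> 2 \<times> (complex ^ 2)) list" where
  "circ_table A01 = [(1, 1, e1), (2, 2, e2)]"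
| "circ_table A02 = [(1, 1, e1), (1, 2, e2), (2, 1, e2)]"
| "circ_table A03 = [(1, 1, e1)]"
| "circ_table A04 = [(1, 1, e2)]"
| "circ_table A05 = [(1, 1, - e2), (2, 1, - e1)]"
| "circ_table (A06 l) = [(2, 1, - e1), (2, 2, l *s e2)]"
| "circ_table A07 = [(2, 1, - e1), (2, 2, e1 - e2)]"
| "circ_table (A08 l) = [(1, 2, (l + 1) *s e1), (2, 1, l *s e1), (2, 2, (l - 1) *s e2)]"
| "circ_table A09 = [(1, 2, - e1), (2, 1, - 2 *s e1), (2, 2, e1 - 3 *s e2)]"
| "circ_table (A10 a b) = [(1, 1, a *s e1), (2, 2, b *s e2)]"
| "circ_table (A11 a b) = [(1, 1, (2 * a - b) *s e1 + e2), (1, 2, a *s e2), (2, 1, b *s e2)]"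
| "circ_table (A12 a b) = [(1, 1, (2 * a - b) *s e1), (1, 2, a *s e2), (2, 1, b *s e2)]"
| "circ_table (A13 a) = [(1, 1, a *s e1), (2, 2, e2)]"
| "circ_table (A14 a) = [(1, 1, a *s e1)]"
| "circ_table (A15 a) = [(1, 1, (2 - a) *s e1), (1, 2, e2), (2, 1, a *s e2)]"
| "circ_table (A16 a) = [(1, 1, (3/2) *s e1 + a *s e2), (1, 2, e2), (2, 1, (1/2) *s e2)]"
| "circ_table A17 = [(1, 1, - e1), (2, 1, e2)]"
| "circ_table (A18 a) = [(1, 1, a *s e2)]"

definition dot_of :: "algebra_name \<Rightarrow> complex ^ 2 \<Rightarrow> complex ^ 2 \<Rightarrow> complex ^ 2"
  where "dot_of N = table_product (dot_table N)"

definition circ_of :: "algebra_name \<Rightarrow> complex ^ 2 \<Rightarrow> complex ^ 2 \<Rightarrow> complex ^ 2"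
  where "circ_of N = table_product (circ_table N)"

lemma linear_table_product_left: "Vector_Spaces.linear (*s) (*s) (\<lambda>x. table_product T x y)"
  unfolding table_product_def
  by unfold_locales
    (induction T; auto simp: vec_eq_iff algebra_simps split: prod.splits)+

lemma linear_table_product_right: "Vector_Spaces.linear (*s) (*s) (\<lambda>y. table_product T x y)"
  unfolding table_product_def
  by unfold_locales
    (induction T; auto simp: vec_eq_iff algebra_simps split: prod.splits)+

text \<open>All listed algebras are anti-pre-Lie Poisson algebras; \<open>list_a\<close> consists of those with
  zero product \<open>\<cdot>\<close> and \<open>list_b\<close> of those with nonzero product \<open>\<cdot>\<close>.\<close>

lemma anti_pre_lie_poisson_algebra_list:
  "anti_pre_lie_poisson_algebra (*s) (dot_of N) (circ_of N)"
proof -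
  interpret anti_pre_lie_algebra "(*s)" "circ_of N"
  proof (intro anti_pre_lie_algebra.intro vec.vector_space_axioms anti_pre_lie_algebra_axioms.intro)
    fix x y z :: "complex ^ 2"
    show "circ_of N x (circ_of N y z) - circ_of N y (circ_of N x z) =
        circ_of N (circ_of N y x - circ_of N x y) z"
      by (cases N; simp add: circ_of_def table_product_def vec_eq_iff forall_2 axis_def field_simps)
    show "circ_of N (circ_of N x y - circ_of N y x) z + circ_of N (circ_of N y z - circ_of N z y) x +
        circ_of N (circ_of N z x - circ_of N x z) y = 0"
      by (cases N; simp add: circ_of_def table_product_def vec_eq_iff forall_2 axis_def field_simps)
  qed (simp_all add: circ_of_def linear_table_product_left linear_table_product_right)
  show ?thesis
  proof (intro anti_pre_lie_poisson_algebra.intro anti_pre_lie_algebra_axioms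
      anti_pre_lie_poisson_algebra_axioms.intro)
    fix x y z :: "complex ^ 2"
    show "dot_of N x y = dot_of N y x"
      by (cases N; simp add: dot_of_def table_product_def vec_eq_iff forall_2 axis_def field_simps)
    show "dot_of N (dot_of N x y) z = dot_of N x (dot_of N y z)"
      by (cases N; simp add: dot_of_def table_product_def vec_eq_iff forall_2 axis_def field_simps)
    show "2 *s dot_of N (circ_of N x y) z - 2 *s dot_of N (circ_of N y x) z =
        dot_of N y (circ_of N x z) - dot_of N x (circ_of N y z)"
      by (cases N; simp add: dot_of_def circ_of_def table_product_def vec_eq_iff forall_2 axis_def
          field_simps)
    show "2 *s circ_of N x (dot_of N y z) =
        circ_of N (dot_of N z x) y + dot_of N z (circ_of N x y)"
      by (cases N; simp add: dot_of_def circ_of_def table_product_def vec_eq_iff forall_2 axis_def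
          field_simps)
  qed (unfold dot_of_def, fact linear_table_product_left, fact linear_table_product_right)
qed

lemma dot_of_list_a: "N \<in> list_a \<Longrightarrow> dot_of N x y = 0"
  by (auto simp: list_a_def dot_of_def table_product_def)

lemma dot_of_list_b: "N \<in> list_b \<Longrightarrow> \<exists>x y. dot_of N x y \<noteq> 0"
  by (rule exI[of _ e1], rule exI[of _ e1])
    (auto simp: list_b_def dot_of_def table_product_def vec_eq_iff forall_2 axis_def)

end

theory Submission
  imports Defs
begin

text \<open>In dimension two an anti-pre-Lie product \<open>\<circ>\<close> is either commutative, hence associative, or its
  left multiplications satisfy \<open>[L\<^sub>v, L\<^sub>u] = L\<^sub>u\<close> in a basis with \<open>[u, v] = u\<close>, which leaves few structure
  constants. This settles zero \<open>\<cdot>\<close>. A nonzero \<open>\<cdot>\<close> has one of four normal forms, and in each of them the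
  second compatibility identity determines \<open>\<circ>\<close> up to the listed parameters. An isomorphism between
  algebras in (b) must preserve the normal form of \<open>\<cdot>\<close>, which makes it nearly diagonal.\<close>

section \<open>Bases of a plane\<close>

locale complex_space = vector_space scale for scale :: "complex \<Rightarrow> 'a::ab_group_add \<Rightarrow> 'a"
begin

text \<open>Vectors are kept in this coordinate form so that \<open>comb_simps\<close> and
  \<open>comb_eq_iff\<close> turn identities between products into equations between complex
  numbers.\<close>

definition comb :: "'a \<Rightarrow> 'a \<Rightarrow> complex \<Rightarrow> complex \<Rightarrow> 'a"
  where "comb u v a b = scale a u + scale b v"

definition basis2 :: "'a \<Rightarrow> 'a \<Rightarrow> bool"
  where "basis2 u v \<longleftrightarrow>
    (\<forall>x. \<exists>a b. x = comb u v a b) \<and> (\<forall>a b. comb u v a b = 0 \<longrightarrow> a = 0 \<and> b = 0)"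

lemma comb_simps:
  "comb u v a b + comb u v c d = comb u v (a + c) (b + d)"
  "comb u v a b - comb u v c d = comb u v (a - c) (b - d)"
  "- comb u v a b = comb u v (- a) (- b)"
  "scale k (comb u v a b) = comb u v (k * a) (k * b)"
  "comb u v 0 0 = 0"
  by (simp_all add: comb_def algebra_simps)

lemma comb_unit: "comb u v 1 0 = u" "comb u v 0 1 = v"
  by (simp_all add: comb_def)

lemma comb_comb:
  "comb (comb u v p q) (comb u v r s) a b = comb u v (a * p + b * r) (a * q + b * s)"
  by (simp add: comb_def algebra_simps)

lemma comb_eq_0_iff: "basis2 u v \<Longrightarrow> comb u v a b = 0 \<longleftrightarrow> a = 0 \<and> b = 0"
  by (auto simp: basis2_def comb_simps)

lemma comb_eq_iff:
  assumes "basis2 u v"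
  shows "comb u v a b = comb u v c d \<longleftrightarrow> a = c \<and> b = d"
proof -
  have "comb u v a b = comb u v c d \<longleftrightarrow> comb u v (a - c) (b - d) = 0"
    by (simp flip: comb_simps(2))
  then show ?thesis
    using assms by (simp add: comb_eq_0_iff)
qed

lemma basis2_expand:
  assumes "basis2 u v"
  obtains a b where "x = comb u v a b"
  using assms unfolding basis2_def by metis

lemma basis2_change:
  assumes "basis2 u v" and det: "p * s - q * r \<noteq> 0"
  shows "basis2 (comb u v p q) (comb u v r s)"
  unfolding basis2_def
proof (intro conjI allI impI)
  fix x
  obtain a b where x: "x = comb u v a b"
    using assms(1) by (rule basis2_expand)
  \<comment> \<open>The coefficients come from Cramer's rule.\<close>
  have "x = comb (comb u v p q) (comb u v r s)
      ((a * s - b * r) / (p * s - q * r)) ((p * b - q * a) / (p * s - q * r))"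
    using det by (simp add: x comb_comb comb_eq_iff[OF assms(1)] divide_simps) (simp add: algebra_simps)
  then show "\<exists>a b. x = comb (comb u v p q) (comb u v r s) a b"
    by blast
next
  fix a b
  assume "comb (comb u v p q) (comb u v r s) a b = 0"
  then have *: "a * p + b * r = 0" "a * q + b * s = 0"
    by (simp_all add: comb_comb comb_eq_0_iff[OF assms(1)])
  have "a * (p * s - q * r) = s * (a * p + b * r) - r * (a * q + b * s)"
    "b * (p * s - q * r) = p * (a * q + b * s) - q * (a * p + b * r)"
    by (simp_all add: algebra_simps)
  then have "a * (p * s - q * r) = 0" "b * (p * s - q * r) = 0"
    unfolding * by simp_all
  then show "a = 0" "b = 0"
    using det by simp_all
qed

lemma basis2_change_right:
  "basis2 u v \<Longrightarrow> s \<noteq> 0 \<Longrightarrow> basis2 u (comb u v r s)"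
  using basis2_change[of u v 1 s 0 r] by (simp add: comb_unit)

text \<open>If \<open>x\<close> is a multiple of \<open>v\<close>, then \<open>u\<close> completes
  it; otherwise \<open>v\<close> does.\<close>

lemma basis2_extend:
  assumes "basis2 u v" "x \<noteq> 0"
  obtains w where "basis2 x w"
proof -
  obtain a b where x: "x = comb u v a b"
    using assms(1) by (rule basis2_expand)
  show thesis
  proof (cases "a = 0")
    case True
    then have "b \<noteq> 0"
      using assms(2) by (auto simp: x comb_simps)
    then show thesis
      using basis2_change[OF assms(1), of a 0 b 1] that by (simp add: x)
  next
    case False
    then show thesis
      using basis2_change[OF assms(1), of a 1 b 0] that by (simp add: x)
  qed
qed

lemma basis2_exists:
  assumes "dim UNIV = 2"
  obtains u v where "basis2 u v"
proof -
  obtain B where B: "independent B" "UNIV \<subseteq> span B" "card B = dim (UNIV :: 'a set)"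
    using basis_exists by blast
  then have "card B = 2"
    using assms by simp
  then obtain u v where uv: "B = {u, v}" "u \<noteq> v"
    by (auto simp: card_2_iff)
  have "finite B"
    using uv by simp
  have "basis2 u v"
    unfolding basis2_def
  proof (intro conjI allI impI)
    fix x
    have "x \<in> span {u, v}"
      using B(2) uv(1) by auto
    then obtain a b where "x - scale a u = scale b v"
      by (auto simp: span_breakdown_eq)
    then show "\<exists>a b. x = comb u v a b"
      by (metis comb_def add.commute diff_add_cancel)
  next
    fix a b :: complex
    define f where "f w = (if w = u then a else b)" for w
    assume "comb u v a b = 0"
    then have "(\<Sum>w\<in>B. scale (f w) w) = 0"
      using uv by (simp add: comb_def f_def)
    then have "\<forall>w\<in>B. f w = 0"
      using independentD[OF B(1) \<open>finite B\<close> subset_refl] by blast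
    then show "a = 0" "b = 0"
      using uv by (auto simp: f_def split: if_splits)
  qed
  then show thesis
    using that by blast
qed

end

section \<open>Commutative associative products on a plane\<close>

locale bilinear_product = complex_space scale
  for scale :: "complex \<Rightarrow> 'a::ab_group_add \<Rightarrow> 'a" +
  fixes mult :: "'a \<Rightarrow> 'a \<Rightarrow> 'a"
  assumes linear_left: "Vector_Spaces.linear scale scale (\<lambda>x. mult x y)"
    and linear_right: "Vector_Spaces.linear scale scale (\<lambda>y. mult x y)"
begin

lemma mult_add: "mult (x + y) z = mult x z + mult y z" "mult x (y + z) = mult x y + mult x z"
  using linear_left linear_right by (simp_all add: Vector_Spaces.linear_iff)

lemma mult_scale: "mult (scale k x) y = scale k (mult x y)" "mult x (scale k y) = scale k (mult x y)"
  using linear_left linear_right by (simp_all add: Vector_Spaces.linear_iff)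

lemma mult_zero: "mult 0 x = 0" "mult x 0 = 0"
  using mult_scale(1)[of 0 0 x] mult_scale(2)[of x 0 0] by simp_all

lemma mult_comb:
  "mult (comb u v a b) y = scale a (mult u y) + scale b (mult v y)"
  "mult x (comb u v a b) = scale a (mult x u) + scale b (mult x v)"
  by (simp_all add: comb_def mult_add mult_scale)

end

locale comm_assoc_product = bilinear_product +
  assumes commute: "mult x y = mult y x"
    and assoc: "mult (mult x y) z = mult x (mult y z)"
begin

text \<open>The cases are the nonzero commutative associative complex algebras of dimension two: C x
  C, the dual numbers C[t]/(t^2), C plus a line with zero product, and the nilpotent algebra t
  C[t]/(t^3).\<close>

definition normal_basis :: "'a \<Rightarrow> 'a \<Rightarrow> bool"
  where "normal_basis u v \<longleftrightarrow> basis2 u v \<and>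
    (mult u u = u \<and> mult u v = 0 \<and> mult v v = v \<or>
     mult u u = u \<and> mult u v = v \<and> mult v v = 0 \<or>
     mult u u = u \<and> mult u v = 0 \<and> mult v v = 0 \<or>
     mult u u = v \<and> mult u v = 0 \<and> mult v v = 0)"

text \<open>Peirce decomposition: multiplication by \<open>e\<close> is a projection, so its
  eigenvalue \<open>b\<close> modulo the line of \<open>e\<close> is 0 or 1. In the first case the
  plane splits off a line annihilated by \<open>e\<close>; in the second \<open>e\<close> is a
  unit.\<close>

lemma normal_basis_if_idempotent:
  assumes "basis2 e w" and e: "mult e e = e"
  shows "\<exists>u v. normal_basis u v"
proof -
  obtain a b where ew: "mult e w = comb e w a b"
    using assms(1) by (rule basis2_expand)
  have "mult e (mult e w) = mult e w"
    by (simp add: e flip: assoc)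
  then have "comb e w (a + b * a) (b * b) = comb e w a b"
    by (simp add: ew mult_comb e comb_simps) (simp add: comb_def algebra_simps)
  then have ab: "b * a = 0" "b * b = b"
    by (simp_all add: comb_eq_iff[OF assms(1)])
  show ?thesis
  proof (cases "b = 0")
    case True
    define z where "z = comb e w (- a) 1"
    have bz: "basis2 e z"
      unfolding z_def using assms(1) by (rule basis2_change_right) simp
    have ez: "mult e z = 0"
      by (simp add: z_def mult_comb e ew True) (simp add: comb_def)
    obtain p q where zz: "mult z z = comb e z p q"
      using bz by (rule basis2_expand)
    \<comment> \<open>By associativity \<open>e\<close> annihilates the square of \<open>z\<close>
      as well, which therefore has no component along \<open>e\<close>.\<close>
    have "mult e (mult z z) = 0"
      by (simp add: ez mult_zero flip: assoc)
    then have "comb e z p 0 = 0"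
      by (simp add: zz mult_comb e ez) (simp add: comb_def)
    then have p: "p = 0"
      by (simp add: comb_eq_0_iff[OF bz])
    show ?thesis
    proof (cases "q = 0")
      case True
      then have "normal_basis e z"
        using bz by (simp add: normal_basis_def e ez zz p comb_def)
      then show ?thesis by blast
    next
      case False
      then have "basis2 e (comb e z 0 (1 / q))"
        by (intro basis2_change_right bz) simp
      then have "normal_basis e (comb e z 0 (1 / q))"
        using False by (simp add: normal_basis_def e ez zz p mult_comb comb_simps)
      then show ?thesis by blast
    qed
  next
    case False
    with ab have [simp]: "a = 0" "b = 1"
      by simp_all
    obtain p q where ww: "mult w w = comb e w p q"
      using assms(1) by (rule basis2_expand)
    \<comment> \<open>Completing the square: \<open>e\<close> is a unit here, and \<open>z\<close>
      squares to \<open>d\<close> times \<open>e\<close>.\<close>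
    define z where "z = comb e w (- q / 2) 1"
    define d where "d = p + q\<^sup>2 / 4"
    have bz: "basis2 e z"
      unfolding z_def using assms(1) by (rule basis2_change_right) simp
    have ez: "mult e z = z"
      by (simp add: z_def mult_comb e ew comb_unit) (simp add: comb_def)
    have we: "mult w e = comb e w 0 1"
      by (simp add: commute[of w e] ew)
    have ee: "mult e e = comb e w 1 0"
      by (simp add: e comb_unit)
    have "mult z z = comb e w d 0"
      by (simp add: z_def mult_comb ee ew we ww comb_simps d_def comb_eq_iff[OF assms(1)])
        (simp add: power2_eq_square)
    then have zz: "mult z z = scale d e"
      by (simp add: comb_def)
    show ?thesis
    proof (cases "d = 0")
      case True
      then have "normal_basis e z"
        using bz by (simp add: normal_basis_def e ez zz)
      then show ?thesis by blast
    next
      case False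
      define r where "r = csqrt d"
      have r: "r \<noteq> 0" "d = r * r"
        using False by (simp_all add: r_def flip: power2_eq_square)
      have ze: "mult z e = z"
        by (simp add: commute[of z e] ez)
      have tab: "mult e e = comb e z 1 0" "mult e z = comb e z 0 1" "mult z e = comb e z 0 1"
        "mult z z = comb e z d 0"
        by (simp_all add: e ez ze zz comb_def)
      \<comment> \<open>As \<open>z / r\<close> squares to the unit \<open>e\<close>, these are the
        complementary orthogonal idempotents \<open>(e + z / r) / 2\<close> and
        \<open>(e - z / r) / 2\<close>.\<close>
      let ?u = "comb e z (1/2) (1 / (2 * r))" and ?v = "comb e z (1/2) (- 1 / (2 * r))"
      have "basis2 ?u ?v"
        using bz r by (intro basis2_change) (simp_all add: divide_simps)
      moreover have "mult ?u ?u = ?u" "mult ?u ?v = 0" "mult ?v ?v = ?v"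
        using r by (simp_all add: mult_comb tab comb_simps comb_eq_iff[OF bz] comb_eq_0_iff[OF bz] field_simps)
      ultimately have "normal_basis ?u ?v"
        by (simp add: normal_basis_def)
      then show ?thesis by blast
    qed
  qed
qed

text \<open>If no nonzero idempotent exists, the product is nilpotent: some \<open>x\<close> has a
  nonzero square, and \<open>x\<close> with its square forms a basis of the last type.\<close>

lemma normal_basis_exists:
  assumes uv: "basis2 u v" and nz: "mult x0 y0 \<noteq> 0"
  shows "\<exists>u v. normal_basis u v"
proof (cases "\<exists>e. e \<noteq> 0 \<and> mult e e = e")
  case True
  then show ?thesis
    using normal_basis_if_idempotent basis2_extend[OF uv] by metis
next
  case False
  then have no_idem: "e = 0" if "mult e e = e" for e
    using that by blast
  \<comment> \<open>Polarization: a commutative product with all squares zero is zero.\<close>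
  have "\<exists>x. mult x x \<noteq> 0"
  proof (rule ccontr)
    assume "\<not> ?thesis"
    then have sq: "mult x x = 0" for x
      by simp
    have "mult x y + mult x y = 0" for x y
      using sq[of "x + y"] sq[of x] sq[of y] commute[of y x] by (simp add: mult_add)
    then have "scale 2 (mult x y) = 0" for x y
      by (metis one_add_one scale_left_distrib scale_one)
    then show False
      using nz by simp
  qed
  then obtain x where xx: "mult x x \<noteq> 0"
    by blast
  then have "x \<noteq> 0"
    by (auto simp: mult_zero)
  then obtain w where bw: "basis2 x w"
    using basis2_extend[OF uv] by blast
  obtain a b where ab: "mult x x = comb x w a b"
    using bw by (rule basis2_expand)
  \<comment> \<open>If the square of \<open>x\<close> were a multiple of \<open>x\<close>, rescaling
    \<open>x\<close> would give an idempotent.\<close>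
  have "b \<noteq> 0"
  proof
    assume b: "b = 0"
    then have "a \<noteq> 0"
      using xx by (auto simp: ab comb_simps)
    then have "scale (1 / a) x = 0"
      by (intro no_idem) (simp add: mult_scale ab b comb_def)
    with \<open>a \<noteq> 0\<close> \<open>x \<noteq> 0\<close> show False
      by simp
  qed
  define y where "y = mult x x"
  have bxy: "basis2 x y"
    unfolding y_def ab using bw \<open>b \<noteq> 0\<close> by (rule basis2_change_right)
  obtain p q where xy: "mult x y = comb x y p q"
    using bxy by (rule basis2_expand)
  have "p = 0"
  proof (rule ccontr)
    assume p: "p \<noteq> 0"
    \<comment> \<open>This solves \<open>mult e x = x\<close>; it then fixes \<open>y\<close>, the
      square of \<open>x\<close>, and hence itself, so it would be a nonzero idempotent.\<close>
    define e where "e = comb x y (- q / p) (1 / p)"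
    have ex: "mult e x = x"
      using p by (simp add: e_def mult_comb commute[of y x] xy flip: y_def) (simp add: comb_def algebra_simps)
    have "mult e y = y"
      by (simp add: y_def ex flip: assoc)
    with ex have "mult e e = e"
      by (subst (2) e_def) (simp add: mult_comb, simp add: e_def comb_def)
    then have "e = 0"
      by (rule no_idem)
    then show False
      using p by (simp add: e_def comb_eq_0_iff[OF bxy])
  qed
  have xy': "mult x y = scale q y"
    by (simp add: xy \<open>p = 0\<close> comb_def)
  have yy: "mult y y = scale (q * q) y"
    by (subst y_def) (simp add: assoc xy' mult_scale)
  have "q = 0"
  proof (rule ccontr)
    assume q: "q \<noteq> 0"
    then have "scale (1 / (q * q)) y = 0"
      by (intro no_idem) (simp add: mult_scale yy)
    then show False
      using q xx by (simp add: y_def)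
  qed
  then have "normal_basis x y"
    using bxy by (simp add: normal_basis_def xy' yy flip: y_def)
  then show ?thesis
    by blast
qed

end

section \<open>Structure constants and isomorphisms\<close>

interpretation plane: complex_space "(*s) :: complex \<Rightarrow> complex ^ 2 \<Rightarrow> complex ^ 2"
  by unfold_locales

lemma comb_axis: "plane.comb e1 e2 (x $ 1) (x $ 2) = x"
  by (simp add: plane.comb_def vec_eq_iff forall_2 axis_def)

lemma bilinear_product_table: "bilinear_product (*s) (table_product T)"
  by (intro bilinear_product.intro bilinear_product_axioms.intro plane.complex_space_axioms
      linear_table_product_left linear_table_product_right)

context bilinear_product
begin

text \<open>Passing through coordinates lets one table on \<open>complex ^ 2\<close> describe
  products on any plane; by bilinearity these four products determine all others.\<close>

definition table_on :: "'a \<Rightarrow> 'a \<Rightarrow> (2 \<times> 2 \<times> (complex ^ 2)) list \<Rightarrow> bool"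
  where "table_on u v T \<longleftrightarrow>
    mult u u = comb u v (table_product T e1 e1 $ 1) (table_product T e1 e1 $ 2) \<and>
    mult u v = comb u v (table_product T e1 e2 $ 1) (table_product T e1 e2 $ 2) \<and>
    mult v u = comb u v (table_product T e2 e1 $ 1) (table_product T e2 e1 $ 2) \<and>
    mult v v = comb u v (table_product T e2 e2 $ 1) (table_product T e2 e2 $ 2)"

lemma mult_eq_table_product:
  assumes "table_on u v T"
  shows "mult (comb u v (x $ 1) (x $ 2)) (comb u v (y $ 1) (y $ 2)) =
    comb u v (table_product T x y $ 1) (table_product T x y $ 2)"
proof -
  interpret T: bilinear_product "(*s)" "table_product T"
    by (rule bilinear_product_table)
  have "table_product T x y =
      table_product T (plane.comb e1 e2 (x $ 1) (x $ 2)) (plane.comb e1 e2 (y $ 1) (y $ 2))"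
    by (simp add: comb_axis)
  also have "\<dots> = (x $ 1) *s ((y $ 1) *s table_product T e1 e1 + (y $ 2) *s table_product T e1 e2) +
      (x $ 2) *s ((y $ 1) *s table_product T e2 e1 + (y $ 2) *s table_product T e2 e2)"
    by (simp add: T.mult_comb algebra_simps)
  finally show ?thesis
    using assms by (simp add: mult_comb comb_simps table_on_def algebra_simps)
qed

end

text \<open>The coordinate map \<open>g\<close> from \<open>complex ^ 2\<close> is bijective and
  preserves both products; the isomorphism is its inverse.\<close>

lemma isomorphic_algebrasI:
  assumes "bilinear_product smul dot" "bilinear_product smul circ"
    and "complex_space.basis2 smul u v"
    and tables: "bilinear_product.table_on smul dot u v (dot_table N)"
      "bilinear_product.table_on smul circ u v (circ_table N)"
  shows "isomorphic_algebras smul dot circ (*s) (dot_of N) (circ_of N)"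
proof -
  interpret dot: bilinear_product smul dot by fact
  interpret circ: bilinear_product smul circ by fact
  define g where "g x = dot.comb u v (x $ 1) (x $ 2)" for x :: "complex ^ 2"
  have "inj g"
    using dot.comb_eq_iff[OF assms(3)] by (auto simp: inj_def g_def vec_eq_iff forall_2)
  moreover have "\<exists>x. y = g x" for y
  proof -
    obtain a b where "y = dot.comb u v a b"
      using assms(3) by (rule dot.basis2_expand)
    then have "y = g (vector [a, b])"
      by (simp add: g_def)
    then show ?thesis
      by blast
  qed
  ultimately have "bij g"
    by (auto simp: bij_def surj_def)
  then have inv: "inv g (g x) = x" "g (inv g y) = y" for x y
    by (simp_all add: bij_is_inj bij_is_surj surj_f_inv_f)
  have g_lin: "g (x + y) = g x + g y" "g (c *s x) = smul c (g x)" for x y c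
    by (simp_all add: g_def dot.comb_simps)
  have g_mult: "g (dot_of N x y) = dot (g x) (g y)" "g (circ_of N x y) = circ (g x) (g y)" for x y
    using dot.mult_eq_table_product[OF tables(1)] circ.mult_eq_table_product[OF tables(2)]
    by (simp_all add: g_def dot_of_def circ_of_def)
  have inv_eq: "inv g y = x" if "y = g x" for x y
    using that inv by simp
  show ?thesis
    unfolding isomorphic_algebras_def
  proof (intro exI[of _ "inv g"] conjI allI)
    show "Vector_Spaces.linear smul (*s) (inv g)"
      unfolding Vector_Spaces.linear_iff
      by (auto intro!: inv_eq simp: g_lin inv dot.vector_space_axioms vec.vector_space_axioms)
    show "bij (inv g)"
      using \<open>bij g\<close> by (rule bij_imp_bij_inv)
  qed (auto intro!: inv_eq simp: g_mult inv)
qed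

text \<open>The isomorphism becomes an invertible matrix with columns \<open>(p, q)\<close> and
  \<open>(r, s)\<close>, which reduces its existence to polynomial equations.\<close>

lemma isomorphic_algebras_planeE:
  assumes "isomorphic_algebras (*s) dot circ (*s) dot' circ'"
  obtains p s q r :: complex and f :: "complex ^ 2 \<Rightarrow> complex ^ 2"
  where "p * s - q * r \<noteq> 0"
    "\<forall>x. f x $ 1 = p * x $ 1 + r * x $ 2" "\<forall>x. f x $ 2 = q * x $ 1 + s * x $ 2"
    "\<forall>x y. f (dot x y) = dot' (f x) (f y)" "\<forall>x y. f (circ x y) = circ' (f x) (f y)"
proof -
  obtain f where f: "Vector_Spaces.linear (*s) (*s) f" "bij f"
    "\<And>x y. f (dot x y) = dot' (f x) (f y)" "\<And>x y. f (circ x y) = circ' (f x) (f y)"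
    using assms by (auto simp: isomorphic_algebras_def)
  have add: "f (x + y) = f x + f y" and smult: "f (c *s x) = c *s f x" for x y c
    using f(1) by (simp_all add: Vector_Spaces.linear_iff)
  define p q r s where pqrs: "p = f e1 $ 1" "q = f e1 $ 2" "r = f e2 $ 1" "s = f e2 $ 2"
  have f_comb: "f x = x $ 1 *s f e1 + x $ 2 *s f e2" for x
    by (subst comb_axis[of x, symmetric]) (simp only: plane.comb_def add smult)
  have fx: "f x $ 1 = p * x $ 1 + r * x $ 2" "f x $ 2 = q * x $ 1 + s * x $ 2" for x
    by (subst f_comb, simp add: pqrs)+
  have "p * s - q * r \<noteq> 0"
  proof
    assume det: "p * s - q * r = 0"
    have f0: "f 0 = 0"
      by (simp add: vec_eq_iff forall_2 fx)
    have inj: "x = 0" if "f x = 0" for x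
      using that f0 \<open>bij f\<close> by (metis bij_is_inj injD)
    \<comment> \<open>A singular matrix annihilates the columns of its adjugate (here up to sign);
      by injectivity they vanish, and so does the matrix.\<close>
    have "f (vector [s, - q]) = 0" "f (vector [r, - p]) = 0"
      using det by (simp_all add: vec_eq_iff forall_2 fx algebra_simps)
    then have "vector [s, - q] = (0 :: complex ^ 2)" "vector [r, - p] = (0 :: complex ^ 2)"
      by (blast dest: inj)+
    then have "f e1 = 0"
      by (simp add: vec_eq_iff forall_2 fx)
    then have "e1 = (0 :: complex ^ 2)"
      by (rule inj)
    then show False
      by simp
  qed
  with fx f(3,4) show thesis
    using that by blast
qed

section \<open>Classification\<close>

sublocale anti_pre_lie_algebra \<subseteq> complex_space scale
  by unfold_locales

sublocale anti_pre_lie_algebra \<subseteq> circ: bilinear_product scale circ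
  by (intro bilinear_product.intro bilinear_product_axioms.intro complex_space_axioms
      circ_linear_left circ_linear_right)

sublocale anti_pre_lie_poisson_algebra \<subseteq> dot: comm_assoc_product scale dot
  by (intro comm_assoc_product.intro comm_assoc_product_axioms.intro bilinear_product.intro
      bilinear_product_axioms.intro complex_space_axioms dot_linear_left dot_linear_right dot_commute
      dot_assoc)

lemmas table_simps = table_product_def axis_def

section \<open>Anti-pre-Lie products on a plane: the algebras of list (a)\<close>

context anti_pre_lie_algebra
begin

text \<open>Without commutators the representation identity says that left multiplications commute,
  which for a commutative product is associativity. The four normal forms are then
  \<open>A01\<close> to \<open>A04\<close>.\<close>

lemma table_if_commutative:
  assumes uv: "basis2 u0 v0" and comm: "\<And>x y. x \<circ>\<circ> y = y \<circ>\<circ> x" and nz: "x0 \<circ>\<circ> y0 \<noteq> 0"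
  shows "\<exists>u v N. basis2 u v \<and> N \<in> list_a \<and> circ.table_on u v (circ_table N)"
proof -
  have "(x \<circ>\<circ> y) \<circ>\<circ> z = x \<circ>\<circ> (y \<circ>\<circ> z)" for x y z
  proof -
    have "z \<circ>\<circ> (x \<circ>\<circ> y) - x \<circ>\<circ> (z \<circ>\<circ> y) = 0"
      unfolding circ_representation by (simp add: comm[of x z] circ.mult_zero)
    then show ?thesis
      by (simp add: comm[of z])
  qed
  then interpret comm_assoc_product scale circ
    by unfold_locales (use comm in auto)
  obtain u v where "normal_basis u v"
    using normal_basis_exists[OF uv nz] by blast
  then have b: "basis2 u v" and
    "circ.table_on u v (circ_table A01) \<or> circ.table_on u v (circ_table A02) \<or>
     circ.table_on u v (circ_table A03) \<or> circ.table_on u v (circ_table A04)"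
    by (auto simp: normal_basis_def circ.table_on_def table_simps comb_unit comb_simps comm[of v u])
  then show ?thesis
    unfolding list_a_def by blast
qed

definition bracket_basis :: "'a \<Rightarrow> 'a \<Rightarrow> bool"
  where "bracket_basis u v \<longleftrightarrow> basis2 u v \<and> u \<circ>\<circ> v - v \<circ>\<circ> u = u"

text \<open>On a plane an alternating bracket is a determinant times a fixed vector
  \<open>w\<close>. Taking \<open>w\<close> first in the basis and rescaling the second vector
  normalizes the bracket.\<close>

lemma bracket_basis_exists:
  assumes uv: "basis2 u v" and nc: "x0 \<circ>\<circ> y0 \<noteq> y0 \<circ>\<circ> x0"
  shows "\<exists>u v. bracket_basis u v"
proof -
  have bracket: "comb x y a b \<circ>\<circ> comb x y c d - comb x y c d \<circ>\<circ> comb x y a b =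
      scale (a * d - b * c) (x \<circ>\<circ> y - y \<circ>\<circ> x)" for x y a b c d
    by (simp add: circ.mult_comb algebra_simps)
  define w where "w = u \<circ>\<circ> v - v \<circ>\<circ> u"
  have "w \<noteq> 0"
  proof
    assume w: "w = 0"
    obtain a b c d where xy: "x0 = comb u v a b" "y0 = comb u v c d"
      using uv by (metis basis2_expand)
    have "x0 \<circ>\<circ> y0 - y0 \<circ>\<circ> x0 = 0"
      using bracket[of u v a b c d] w by (simp add: w_def xy)
    then show False
      using nc by simp
  qed
  then obtain z where wz: "basis2 w z"
    using basis2_extend[OF uv] by blast
  obtain a b c d where coords: "u = comb w z a b" "v = comb w z c d"
    using wz by (metis basis2_expand)
  have "w = comb w z a b \<circ>\<circ> comb w z c d - comb w z c d \<circ>\<circ> comb w z a b"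
    unfolding coords[symmetric] by (rule w_def)
  then have w: "w = scale (a * d - b * c) (w \<circ>\<circ> z - z \<circ>\<circ> w)"
    by (simp only: bracket)
  have det: "a * d - b * c \<noteq> 0"
  proof
    assume "a * d - b * c = 0"
    with w have "w = 0"
      by (metis scale_zero_left)
    with \<open>w \<noteq> 0\<close> show False ..
  qed
  have "w \<circ>\<circ> comb w z 0 (a * d - b * c) - comb w z 0 (a * d - b * c) \<circ>\<circ> w = w"
    using bracket[of w z 1 0 0 "a * d - b * c"] by (simp add: comb_unit flip: w)
  then have "bracket_basis w (comb w z 0 (a * d - b * c))"
    using basis2_change_right[OF wz det] by (simp add: bracket_basis_def)
  then show ?thesis
    by blast
qed

text \<open>Adding a multiple of \<open>u\<close> to \<open>v\<close> does not change the bracket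
  with \<open>u\<close>. This freedom serves to simplify the structure constants.\<close>

lemma bracket_basis_shift: "bracket_basis u v \<Longrightarrow> bracket_basis u (comb u v t 1)"
  using basis2_change_right[of u v 1 t]
  by (simp add: bracket_basis_def circ.mult_comb algebra_simps)

text \<open>The representation identity gives \<open>[L\<^sub>v, L\<^sub>u] = L\<^sub>u\<close> for the left multiplications, whence
  \<open>L\<^sub>u\<close> is nilpotent.\<close>

lemma bracket_basis_coefficients:
  assumes "bracket_basis u v"
  obtains a k b d1 d2 where
    "u \<circ>\<circ> u = comb u v a k" "u \<circ>\<circ> v = comb u v b (- a)"
    "v \<circ>\<circ> u = comb u v (b - 1) (- a)" "v \<circ>\<circ> v = comb u v d1 d2"
    "a * b + k * d1 = a" "b * k + 2 * a * a = k * d2" "2 * a * d1 + d2 * b = b * (b - 2)"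
proof -
  have uv: "basis2 u v" and br: "u \<circ>\<circ> v - v \<circ>\<circ> u = u"
    using assms by (auto simp: bracket_basis_def)
  obtain a k b b2 d1 d2 where eqs: "u \<circ>\<circ> u = comb u v a k" "u \<circ>\<circ> v = comb u v b b2"
    "v \<circ>\<circ> v = comb u v d1 d2"
    using uv by (metis basis2_expand)
  have "v \<circ>\<circ> u = u \<circ>\<circ> v - comb u v 1 0"
    using br by (simp add: comb_unit algebra_simps)
  then have vu: "v \<circ>\<circ> u = comb u v (b - 1) b2"
    by (simp add: eqs comb_simps)
  have br': "v \<circ>\<circ> u - u \<circ>\<circ> v = comb u v (- 1) 0"
    by (simp add: eqs vu comb_simps)
  have r: "b2 * b - k * d1 = - a" "b * k + b2 * b2 - a * b2 - k * d2 = 0"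
    "d1 * a + d2 * b - b * (b - 1) - b2 * d1 = - b" "d1 * k - b * b2 = - b2"
    using circ_representation[of u v u] circ_representation[of u v v]
    by (simp_all add: br' eqs vu circ.mult_comb comb_simps comb_eq_iff[OF uv] algebra_simps)
  \<comment> \<open>The left multiplication by \<open>u\<close> has trace zero, being a commutator;
    here the first and last equations are added.\<close>
  then have "b2 = - a"
    by algebra
  with r show thesis
    using that[of a k b d1 d2] eqs vu by (simp add: algebra_simps)
qed

text \<open>A nonzero \<open>k\<close> leads to \<open>A05\<close>. Otherwise \<open>u\<close> spans
  an ideal, and \<open>b\<close> decides between \<open>A06\<close>, \<open>A07\<close> (zero) and
  \<open>A08\<close>, \<open>A09\<close> (nonzero).\<close>

lemma table_if_bracket_basis:
  assumes "bracket_basis u v"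
  shows "\<exists>u v N. basis2 u v \<and> N \<in> list_a \<and> circ.table_on u v (circ_table N)"
proof -
  have uv: "basis2 u v"
    using assms by (simp add: bracket_basis_def)
  obtain a k b d1 d2 where t:
    "u \<circ>\<circ> u = comb u v a k" "u \<circ>\<circ> v = comb u v b (- a)"
    "v \<circ>\<circ> u = comb u v (b - 1) (- a)" "v \<circ>\<circ> v = comb u v d1 d2"
    and e: "a * b + k * d1 = a" "b * k + 2 * a * a = k * d2" "2 * a * d1 + d2 * b = b * (b - 2)"
    using assms by (rule bracket_basis_coefficients)
  note simps = circ.table_on_def table_simps t circ.mult_comb comb_simps comb_comb comb_eq_iff[OF uv]
  show ?thesis
  proof (cases "k = 0")
    case False
    \<comment> \<open>The shift makes the square of \<open>u\<close> equal to \<open>k\<close> times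
      \<open>z\<close>, so the coefficient equations are read off again with
      \<open>a' = 0\<close>.\<close>
    define z where "z = comb u v (a / k) 1"
    have "bracket_basis u z"
      unfolding z_def using assms by (rule bracket_basis_shift)
    then have uz: "basis2 u z"
      by (simp add: bracket_basis_def)
    obtain a' k' b' d1' d2' where t':
      "u \<circ>\<circ> u = comb u z a' k'" "u \<circ>\<circ> z = comb u z b' (- a')"
      "z \<circ>\<circ> u = comb u z (b' - 1) (- a')" "z \<circ>\<circ> z = comb u z d1' d2'"
      and e': "a' * b' + k' * d1' = a'" "b' * k' + 2 * a' * a' = k' * d2'"
        "2 * a' * d1' + d2' * b' = b' * (b' - 2)"
      using \<open>bracket_basis u z\<close> by (rule bracket_basis_coefficients)
    have "u \<circ>\<circ> u = comb u z 0 k"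
      using False by (simp add: t z_def) (simp add: comb_def algebra_simps)
    then have a': "a' = 0" "k' = k"
      by (simp_all add: t'(1) comb_eq_iff[OF uz])
    with e' False have d: "d1' = 0" "d2' = b'" and "b' * b' = b' * (b' - 2)"
      by auto
    then have b': "b' = 0"
      by (simp add: algebra_simps)
    \<comment> \<open>Scaling \<open>u\<close> by \<open>c\<close> turns its square into
      \<open>- z\<close>, the sign used in \<open>A05\<close>.\<close>
    define c where "c = csqrt (- 1 / k)"
    have c: "c * c * k = - 1"
      using False by (simp add: c_def flip: power2_eq_square)
    then have "c \<noteq> 0"
      by auto
    define w where "w = comb u z c 0"
    have "basis2 w (comb u z 0 1)"
      unfolding w_def using uz \<open>c \<noteq> 0\<close> by (intro basis2_change) auto
    moreover have "circ.table_on w (comb u z 0 1) (circ_table A05)"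
      using c by (simp add: w_def circ.table_on_def table_simps t' a' d b' circ.mult_comb comb_simps
          comb_comb comb_eq_iff[OF uz] algebra_simps)
    moreover have "A05 \<in> list_a"
      by (simp add: list_a_def)
    ultimately show ?thesis
      by blast
  next
    case True
    then have [simp]: "a = 0" "k = 0"
      using e by auto
    show ?thesis
    proof (cases "b = 0")
      case b: True
      show ?thesis
      proof (cases "d2 = - 1")
        case d2: True
        show ?thesis
        proof (cases "d1 = 0")
          case True
          then have "circ.table_on u v (circ_table (A06 (- 1)))"
            by (simp add: simps b d2)
          moreover have "A06 (- 1) \<in> list_a"
            by (simp add: list_a_def)
          ultimately show ?thesis
            using uv by blast
        next
          case False
          then have "basis2 (comb u v d1 0) (comb u v 0 1)"
            by (intro basis2_change uv) simp
          moreover have "circ.table_on (comb u v d1 0) (comb u v 0 1) (circ_table A07)"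
            by (simp add: simps b d2)
          moreover have "A07 \<in> list_a"
            by (simp add: list_a_def)
          ultimately show ?thesis
            by blast
        qed
      next
        case False
        then have [simp]: "1 + d2 \<noteq> 0"
          by (metis add_eq_0_iff)
        \<comment> \<open>Replacing \<open>v\<close> by \<open>v + t u\<close> changes
          \<open>d1\<close> to \<open>d1 - t (1 + d2)\<close>. For \<open>d2 = - 1\<close> no shift
          helps, and a nonzero \<open>d1\<close> is scaled to 1 instead, giving
          \<open>A07\<close>.\<close>
        define t where "t = d1 / (1 + d2)"
        have d1: "d1 = t * (1 + d2)"
          by (simp add: t_def)
        have "basis2 (comb u v 1 0) (comb u v t 1)"
          by (intro basis2_change uv) simp
        moreover have "circ.table_on (comb u v 1 0) (comb u v t 1) (circ_table (A06 d2))"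
          by (simp add: simps b) (simp add: d1 algebra_simps)
        moreover have "A06 d2 \<in> list_a"
          by (simp add: list_a_def)
        ultimately show ?thesis
          by blast
      qed
    next
      case False
      then have d2: "d2 = b - 2"
        using e(3) by (simp add: mult.commute)
      \<comment> \<open>The parameter is \<open>b - 1\<close>, so the excluded value -1 corresponds
        to \<open>b = 0\<close>, treated above.\<close>
      have in_list: "A08 (b - 1) \<in> list_a"
        using False by (simp add: list_a_def)
      show ?thesis
      proof (cases "b = - 1")
        case b: True
        show ?thesis
        proof (cases "d1 = 0")
          case True
          then have "circ.table_on u v (circ_table (A08 (b - 1)))"
            by (simp add: simps b d2)
          then show ?thesis
            using uv in_list by blast
        next
          case False
          then have "basis2 (comb u v d1 0) (comb u v 0 1)"
            by (intro basis2_change uv) simp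
          moreover have "circ.table_on (comb u v d1 0) (comb u v 0 1) (circ_table A09)"
            by (simp add: simps b d2)
          moreover have "A09 \<in> list_a"
            by (simp add: list_a_def)
          ultimately show ?thesis
            by blast
        qed
      next
        case False
        then have [simp]: "1 + b \<noteq> 0"
          by (metis add_eq_0_iff)
        \<comment> \<open>The shift now changes \<open>d1\<close> to \<open>d1 + t (1 + b)\<close>;
          the exception \<open>b = - 1\<close> produced \<open>A09\<close>.\<close>
        define t where "t = - d1 / (1 + b)"
        have d1: "d1 = - t * (1 + b)"
          by (simp add: t_def)
        have "basis2 (comb u v 1 0) (comb u v t 1)"
          by (intro basis2_change uv) simp
        moreover have "circ.table_on (comb u v 1 0) (comb u v t 1) (circ_table (A08 (b - 1)))"
          by (simp add: simps d2) (simp add: d1 algebra_simps)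
        ultimately show ?thesis
          using in_list by blast
      qed
    qed
  qed
qed

end

section \<open>Nonzero commutative product: the algebras of list (b)\<close>

context anti_pre_lie_poisson_algebra
begin

text \<open>Once the commutative product is in normal form, \<open>circ_dot\<close> on the eight
  triples of basis vectors is a linear system for the structure constants of \<open>circ\<close>.
  Basis changes preserving the normal form then remove redundant parameters.\<close>

lemma tables_if_normal_basis:
  assumes "dot.normal_basis u v"
  shows "\<exists>u v N. basis2 u v \<and> N \<in> list_b \<and>
    dot.table_on u v (dot_table N) \<and> circ.table_on u v (circ_table N)"
proof -
  have uv: "basis2 u v"
    using assms by (simp add: dot.normal_basis_def)
  obtain a1 a2 where uu: "u \<circ>\<circ> u = comb u v a1 a2"
    using uv by (rule basis2_expand)
  obtain b1 b2 where uv': "u \<circ>\<circ> v = comb u v b1 b2"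
    using uv by (rule basis2_expand)
  obtain c1 c2 where vu: "v \<circ>\<circ> u = comb u v c1 c2"
    using uv by (rule basis2_expand)
  obtain d1 d2 where vv: "v \<circ>\<circ> v = comb u v d1 d2"
    using uv by (rule basis2_expand)
  note t = uu uv' vu vv
  note axioms = circ_dot[of u u u] circ_dot[of u u v] circ_dot[of u v u] circ_dot[of u v v]
    circ_dot[of v u u] circ_dot[of v u v] circ_dot[of v v u] circ_dot[of v v v]
  note simps = dot.table_on_def circ.table_on_def table_simps t dot.mult_comb circ.mult_comb
    comb_simps comb_comb comb_eq_iff[OF uv] comb_eq_0_iff[OF uv]
  from assms consider
    (sum) "u \<bullet>\<bullet> u = comb u v 1 0" "u \<bullet>\<bullet> v = comb u v 0 0" "v \<bullet>\<bullet> v = comb u v 0 1"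
  | (dual) "u \<bullet>\<bullet> u = comb u v 1 0" "u \<bullet>\<bullet> v = comb u v 0 1" "v \<bullet>\<bullet> v = comb u v 0 0"
  | (idem) "u \<bullet>\<bullet> u = comb u v 1 0" "u \<bullet>\<bullet> v = comb u v 0 0" "v \<bullet>\<bullet> v = comb u v 0 0"
  | (nil) "u \<bullet>\<bullet> u = comb u v 0 1" "u \<bullet>\<bullet> v = comb u v 0 0" "v \<bullet>\<bullet> v = comb u v 0 0"
    by (auto simp: dot.normal_basis_def comb_simps comb_unit)
  then show ?thesis
  proof cases
    case sum
    note d = sum dot_commute[of v u, unfolded sum]
    have "a2 = 0" "b1 = 0" "b2 = 0" "c1 = 0" "c2 = 0" "d1 = 0"
      using axioms by (simp_all add: simps d circ.mult_zero)
    then have "dot.table_on u v (dot_table (A10 a1 d2))" "circ.table_on u v (circ_table (A10 a1 d2))"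
      by (simp_all add: simps d)
    moreover have "A10 a1 d2 \<in> list_b"
      by (simp add: list_b_def)
    ultimately show ?thesis
      using uv by blast
  next
    case dual
    note d = dual dot_commute[of v u, unfolded dual]
    have h: "2 * b1 = c1" "2 * b2 = c2 + a1" "d1 = 0" "d2 + b1 = 0" "2 * d2 = c1"
      using axioms by (simp_all add: simps d circ.mult_zero)
    \<comment> \<open>Both doubles equal \<open>c1\<close>, so \<open>d2\<close> is at once
      \<open>b1\<close> and its negative.\<close>
    then have "d2 + d2 = b1 + b1" "d2 = - b1"
      by (simp_all add: eq_neg_iff_add_eq_0)
    then have "b1 = 0"
      by simp
    with h have e: "b1 = 0" "c1 = 0" "d1 = 0" "d2 = 0" and a1: "a1 = 2 * b2 - c2"
      by auto
    show ?thesis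
    proof (cases "a2 = 0")
      case True
      then have "dot.table_on u v (dot_table (A12 b2 c2))" "circ.table_on u v (circ_table (A12 b2 c2))"
        by (simp_all add: simps d e a1)
      moreover have "A12 b2 c2 \<in> list_b"
        by (simp add: list_b_def)
      ultimately show ?thesis
        using uv by blast
    next
      case False
      \<comment> \<open>Scaling the nilpotent vector \<open>v\<close> preserves the dual numbers and
        normalizes \<open>a2\<close> to 1.\<close>
      then have "basis2 (comb u v 1 0) (comb u v 0 a2)"
        by (intro basis2_change uv) simp
      moreover have "dot.table_on (comb u v 1 0) (comb u v 0 a2) (dot_table (A11 b2 c2))"
        "circ.table_on (comb u v 1 0) (comb u v 0 a2) (circ_table (A11 b2 c2))"
        by (simp_all add: simps d e a1)
      moreover have "A11 b2 c2 \<in> list_b"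
        by (simp add: list_b_def)
      ultimately show ?thesis
        by blast
    qed
  next
    case idem
    note d = idem dot_commute[of v u, unfolded idem]
    have e: "a2 = 0" "b1 = 0" "b2 = 0" "c1 = 0" "c2 = 0" "d1 = 0"
      using axioms by (simp_all add: simps d circ.mult_zero)
    show ?thesis
    proof (cases "d2 = 0")
      case True
      then have "dot.table_on u v (dot_table (A14 a1))" "circ.table_on u v (circ_table (A14 a1))"
        by (simp_all add: simps d e)
      moreover have "A14 a1 \<in> list_b"
        by (simp add: list_b_def)
      ultimately show ?thesis
        using uv by blast
    next
      case False
      then have "basis2 (comb u v 1 0) (comb u v 0 (1 / d2))"
        by (intro basis2_change uv) simp
      moreover have "dot.table_on (comb u v 1 0) (comb u v 0 (1 / d2)) (dot_table (A13 a1))"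
        "circ.table_on (comb u v 1 0) (comb u v 0 (1 / d2)) (circ_table (A13 a1))"
        using False by (simp_all add: simps d e)
      moreover have "A13 a1 \<in> list_b"
        by (simp add: list_b_def)
      ultimately show ?thesis
        by blast
    qed
  next
    case nil
    note d = nil dot_commute[of v u, unfolded nil]
    have h: "2 * b1 = c1" "2 * b2 = c2 + a1" "d1 = 0" "d2 + b1 = 0" "2 * d2 = c1"
      using axioms by (simp_all add: simps d circ.mult_zero)
    then have "d2 + d2 = b1 + b1" "d2 = - b1"
      by (simp_all add: eq_neg_iff_add_eq_0)
    then have "b1 = 0"
      by simp
    with h have e: "b1 = 0" "c1 = 0" "d1 = 0" "d2 = 0" and a1: "a1 = 2 * b2 - c2"
      by auto
    \<comment> \<open>Any basis of the nilpotent type has this shape, since the square of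
      \<open>p u + r v\<close> is \<open>p * p\<close> times \<open>v\<close>.\<close>
    have change: "\<exists>u v N. basis2 u v \<and> N \<in> list_b \<and>
        dot.table_on u v (dot_table N) \<and> circ.table_on u v (circ_table N)"
      if "N \<in> list_b" "p \<noteq> 0" "dot.table_on (comb u v p r) (comb u v 0 (p * p)) (dot_table N)"
        "circ.table_on (comb u v p r) (comb u v 0 (p * p)) (circ_table N)" for N p r
    proof -
      have "basis2 (comb u v p r) (comb u v 0 (p * p))"
        using \<open>p \<noteq> 0\<close> by (intro basis2_change uv) simp
      with that show ?thesis
        by blast
    qed
    show ?thesis
    proof (cases "b2 = 0")
      case b2: True
      show ?thesis
      proof (cases "c2 = 0")
        case True
        show ?thesis
          by (rule change[of "A18 a2" 1 0]) (simp_all add: list_b_def simps d e a1 b2 True)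
      next
        case False
        then show ?thesis
          \<comment> \<open>The scale normalizes \<open>c2\<close> to 1, and the shear removes the
            remaining \<open>v\<close>-component from the square of \<open>u\<close>.\<close>
          by (intro change[of A17 "1 / c2" "- a2 / (2 * c2 * c2)"])
            (simp_all add: list_b_def simps d e a1 b2 field_simps)
      qed
    next
      case b2: False
      \<comment> \<open>Scaling \<open>u\<close> by \<open>1 / b2\<close> makes right multiplication
        by \<open>v\<close> send \<open>u\<close> to \<open>v\<close>; the ratio \<open>g\<close> is
        the surviving parameter.\<close>
      define g where "g = c2 / b2"
      have c2: "c2 = b2 * g"
        using b2 by (simp add: g_def)
      show ?thesis
      proof (cases "g = 1 / 2")
        case True
        show ?thesis
          using b2 by (intro change[of "A16 a2" "1 / b2" 0])
            (simp_all add: list_b_def simps d e a1 c2 True field_simps)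
      next
        case False
        then have "1 - 2 * g \<noteq> 0"
          by (auto simp: field_simps)
        \<comment> \<open>This shear absorbs \<open>a2\<close>. At \<open>g = 1 / 2\<close> shears
          have no effect on it, and it persists as the parameter of \<open>A16\<close>.\<close>
        define t where "t = a2 / (b2 * b2 * (1 - 2 * g))"
        have a2: "a2 = t * (b2 * b2 * (1 - 2 * g))"
          using b2 \<open>1 - 2 * g \<noteq> 0\<close> by (simp add: t_def)
        show ?thesis
          using b2 False by (intro change[of "A15 g" "1 / b2" t])
            (simp_all add: list_b_def simps d e a1 c2 a2 field_simps)
      qed
    qed
  qed
qed

lemma isomorphic_to_list:
  assumes "dim UNIV = 2" "\<not> ((\<forall>x y. x \<bullet>\<bullet> y = 0) \<and> (\<forall>x y. x \<circ>\<circ> y = 0))"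
  shows "\<exists>N \<in> list_a \<union> list_b. isomorphic_algebras scale dot circ (*s) (dot_of N) (circ_of N)"
proof -
  obtain u0 v0 where uv: "basis2 u0 v0"
    using assms(1) by (rule basis2_exists)
  have "\<exists>u v N. basis2 u v \<and> N \<in> list_a \<union> list_b \<and>
      dot.table_on u v (dot_table N) \<and> circ.table_on u v (circ_table N)"
  proof (cases "\<forall>x y. x \<bullet>\<bullet> y = 0")
    case True
    then have "\<exists>u v N. basis2 u v \<and> N \<in> list_a \<and> circ.table_on u v (circ_table N)"
      using assms(2) table_if_commutative[OF uv] bracket_basis_exists[OF uv] table_if_bracket_basis
      by metis
    moreover have "dot.table_on u v (dot_table N)" if "N \<in> list_a" for u v N
      using that True by (auto simp: list_a_def dot.table_on_def table_product_def comb_simps)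
    ultimately show ?thesis
      by blast
  next
    case False
    then show ?thesis
      using dot.normal_basis_exists[OF uv] tables_if_normal_basis by blast
  qed
  then show ?thesis
    using isomorphic_algebrasI[OF dot.bilinear_product_axioms circ.bilinear_product_axioms] by blast
qed

end

section \<open>Isomorphisms within the list\<close>

lemma list_b_isomorphic_imp:
  assumes "M \<in> list_b" "N \<in> list_b"
    and "isomorphic_algebras (*s) (dot_of M) (circ_of M) (*s) (dot_of N) (circ_of N)"
  shows "M = N \<or> (\<exists>a b. M = A10 a b \<and> N = A10 b a)"
proof -
  obtain p s q r f where det: "p * s - q * r \<noteq> 0"
    and fx: "\<forall>x. f x $ 1 = p * x $ 1 + r * x $ 2" "\<forall>x. f x $ 2 = q * x $ 1 + s * x $ 2"
    and dot: "\<forall>x y. f (dot_of M x y) = dot_of N (f x) (f y)"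
    and circ: "\<forall>x y. f (circ_of M x y) = circ_of N (f x) (f y)"
    using assms(3) by (rule isomorphic_algebras_planeE)
  note simps = vec_eq_iff forall_2 fx[rule_format] dot_of_def circ_of_def table_simps list_b_def
  note dots = dot[rule_format, of e1 e1, symmetric] dot[rule_format, of e1 e2, symmetric]
    dot[rule_format, of e2 e2, symmetric]
  note circs = circ[rule_format, of e1 e1, symmetric] circ[rule_format, of e1 e2, symmetric]
    circ[rule_format, of e2 e1, symmetric] circ[rule_format, of e2 e2, symmetric]
  let ?D = "{A11 a b | a b. True} \<union> {A12 a b | a b. True}" and ?I = "range A13 \<union> range A14"
    and ?Z = "range A15 \<union> range A16 \<union> {A17} \<union> range A18"
  \<comment> \<open>The commutative product alone fixes the type and restricts the matrix:
    idempotents of C x C are permuted; in \<open>?D\<close> the unit and the nilpotent line, in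
    \<open>?I\<close> the idempotent and the annihilator, are preserved; in \<open>?Z\<close> the
    image of \<open>e1\<close> determines that of its square \<open>e2\<close>.\<close>
  consider (sum) "\<exists>a b a' b'. M = A10 a b \<and> N = A10 a' b'"
      "p = 1 \<and> q = 0 \<and> r = 0 \<and> s = 1 \<or> p = 0 \<and> q = 1 \<and> r = 1 \<and> s = 0"
    | (unit) "M \<in> ?D \<and> N \<in> ?D \<or> M \<in> ?I \<and> N \<in> ?I" "p = 1" "q = 0" "r = 0"
    | (nil) "M \<in> ?Z" "N \<in> ?Z" "r = 0" "s = p * p"
    using assms(1,2)[unfolded list_b_def] det dots
    by (elim UnE rangeE CollectE exE insertE emptyE conjE)
      (simp_all add: simps image_iff, (elim conjE disjE; simp)+)
  then show ?thesis
  proof cases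
    case sum
    then show ?thesis
      using circ[rule_format, of e1 e1, symmetric] circ[rule_format, of e2 e2, symmetric]
      by (elim exE conjE disjE) (simp_all add: simps)
  next
    case unit
    \<comment> \<open>Only the scale of \<open>e2\<close> is still free; being nonzero, it can turn
      neither \<open>A11\<close> into \<open>A12\<close> nor \<open>A13\<close> into
      \<open>A14\<close>.\<close>
    have "s \<noteq> 0"
      using unit det by simp
    then show ?thesis
      using assms(1,2) unit circs
      by (elim conjE disjE UnE rangeE CollectE exE) (simp_all add: simps)
  next
    case nil
    \<comment> \<open>Left and right multiplication by \<open>e1\<close> act on \<open>e2\<close> by
      scalars that are determined up to the common factor \<open>p\<close>; these separate the four
      families, as \<alpha> = 1/2 is excluded in \<open>A15\<close>.\<close>
    have "p \<noteq> 0"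
      using nil det by auto
    then show ?thesis
      using assms(1,2) nil circs
      by (elim conjE disjE UnE rangeE CollectE exE insertE emptyE)
        (simp_all add: simps image_iff, auto simp: field_simps)
  qed
qed

lemma isomorphic_algebras_refl:
  "isomorphic_algebras (*s) (dot_of N) (circ_of N) (*s) (dot_of N) (circ_of N)"
  unfolding isomorphic_algebras_def
  by (rule exI[of _ id]) (simp add: Vector_Spaces.linear_iff vec.vector_space_axioms)

text \<open>The isomorphism exchanges the two orthogonal idempotents.\<close>

lemma A10_swap:
  "isomorphic_algebras (*s) (dot_of (A10 a b)) (circ_of (A10 a b))
     (*s) (dot_of (A10 b a)) (circ_of (A10 b a))"
proof -
  interpret D: bilinear_product "(*s)" "dot_of (A10 a b)"
    unfolding dot_of_def by (rule bilinear_product_table)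
  interpret C: bilinear_product "(*s)" "circ_of (A10 a b)"
    unfolding circ_of_def by (rule bilinear_product_table)
  note simps = dot_of_def circ_of_def table_simps plane.comb_def vec_eq_iff forall_2
  have "x = plane.comb e2 e1 (x $ 2) (x $ 1)" for x
    by (simp add: simps)
  then have "plane.basis2 e2 e1"
    unfolding plane.basis2_def by (intro conjI) (blast, simp add: simps)
  moreover have "D.table_on e2 e1 (dot_table (A10 b a))" "C.table_on e2 e1 (circ_table (A10 b a))"
    unfolding D.table_on_def C.table_on_def by (simp_all add: simps)
  ultimately show ?thesis
    by (intro isomorphic_algebrasI D.bilinear_product_axioms C.bilinear_product_axioms)
qed

theorem theorem57:
  shows "(\<forall>(smul :: complex \<Rightarrow> 'a::ab_group_add \<Rightarrow> 'a) dot circ.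
            anti_pre_lie_poisson_algebra smul dot circ \<and>
            vector_space.dim smul UNIV = 2 \<and>
            \<not> ((\<forall>x y. dot x y = 0) \<and> (\<forall>x y. circ x y = 0)) \<longrightarrow>
            (\<exists>N \<in> list_a \<union> list_b.
               isomorphic_algebras smul dot circ (*s) (dot_of N) (circ_of N)))
       \<and> (\<forall>M \<in> list_b. \<forall>N \<in> list_b.
            isomorphic_algebras (*s) (dot_of M) (circ_of M) (*s) (dot_of N) (circ_of N) \<longleftrightarrow>
            M = N \<or> (\<exists>a b. M = A10 a b \<and> N = A10 b a))"
proof (intro conjI allI impI ballI)
  fix smul :: "complex \<Rightarrow> 'a \<Rightarrow> 'a" and dot circ
  assume "anti_pre_lie_poisson_algebra smul dot circ \<and> vector_space.dim smul UNIV = 2 \<and>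
    \<not> ((\<forall>x y. dot x y = 0) \<and> (\<forall>x y. circ x y = 0))"
  then show "\<exists>N \<in> list_a \<union> list_b. isomorphic_algebras smul dot circ (*s) (dot_of N) (circ_of N)"
    by (elim conjE) (rule anti_pre_lie_poisson_algebra.isomorphic_to_list)
next
  fix M N
  assume "M \<in> list_b" "N \<in> list_b"
  then show "isomorphic_algebras (*s) (dot_of M) (circ_of M) (*s) (dot_of N) (circ_of N) \<longleftrightarrow>
      M = N \<or> (\<exists>a b. M = A10 a b \<and> N = A10 b a)"
    using list_b_isomorphic_imp isomorphic_algebras_refl A10_swap by metis
qed

end
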